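(* The $\mathcal{M}$-, $\mathcal{R}$-, $\mathcal{M}^{\to c}$- and $\mathcal{M}^{c\to}$-transforms are bijections from the set $\mathcal{X}[\mathcal{P}]$ of characters of $\bigoplus_{k=0}^{\infty}\mathbb{C}[\mathcal{P}_k/\mathfrak{S}_k]$ to itself.
   Context: $\mathcal{P}_k$ is the set of partitions of $\{1,\dots,k\}\cup\{1',\dots,k'\}$, $\mathcal{P}_0=\{\emptyset\}$, $\mathrm{id}_k=\{\{i,i'\}:1\le i\le k\}$. $\mathfrak{S}_k$ acts on $\mathcal{P}_k$ by simultaneously permuting the labels $1,\dots,k$ and $1',\dots,k'$; $\mathbf{p}=[p]$ is the orbit of $p$. For $p\in\mathcal{P}_k$, $q\in\mathcal{P}_l$, $p\otimes q\in\mathcal{P}_{k+l}$ is obtained by placing $q$ to the right of $p$ (labels $i,i'$ of $q$ become $k+i,(k+i)'$); $[p]\otimes[q]=[p\otimes q]$ is well defined. Linear forms on $\bigoplus_k\mathbb{C}[\mathcal{P}_k/\mathfrak{S}_k]$ are identified with linear forms on $\bigoplus_k\mathbb{C}[\mathcal{P}_k]$ invariant under the $\mathfrak{S}_k$-actions. $\mathrm{nc}(p)$ is the number of blocks; $p\vee p'$ is the finest partition coarser than both; $d(p,p')=\frac12(\mathrm{nc}(p)+\mathrm{nc}(p'))-\mathrm{nc}(p\vee p')$. Orders on $\mathcal{P}_k$: - $p'\leq p$ if $d(\mathrm{id}_k,p')+d(p',p)=d(\mathrm{id}_k,p)$; - $p'\dashv p$ if $p'$ is coarser than $p$ and $\mathrm{nc}(p'\vee\mathrm{id}_k)=\mathrm{nc}(p\vee\mathrm{id}_k)$;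 - $p'\sqsupset p$ if $p'$ is finer than $p$ and $\mathrm{nc}(p')-\mathrm{nc}(p'\vee\mathrm{id}_k)=\mathrm{nc}(p)-\mathrm{nc}(p\vee\mathrm{id}_k)$. Transforms: $(\mathcal{M}(\phi))(p)=\sum_{p'\leq p}\phi(p')$, $(\mathcal{M}^{\to c}(\phi))(p)=\sum_{p'\sqsupset p}\phi(p')$, $(\mathcal{M}^{c\to}(\phi))(p)=\sum_{p'\dashv p}\phi(p')$, for $p\in\mathcal{P}_k$ (sums over $p'\in\mathcal{P}_k$). $\mathcal{M}$ is invertible and $\mathcal{R}=\mathcal{M}^{-1}$. These transforms preserve invariant forms, hence are defined on $\left(\bigoplus_k\mathbb{C}[\mathcal{P}_k/\mathfrak{S}_k]\right)^{*}$. A character is a linear form $\phi$ on $\bigoplus_k\mathbb{C}[\mathcal{P}_k/\mathfrak{S}_k]$ with $\phi(\emptyset)=1$ and $\phi(\mathbf{p_1}\otimes\mathbf{p_2})=\phi(\mathbf{p_1})\phi(\mathbf{p_2})$ for all orbits $\mathbf{p_1},\mathbf{p_2}$; $\mathcal{X}[\mathcal{P}]$ is the set of characters. *)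

theory Defs
  imports
    Complex_Main
    "HOL-Library.Disjoint_Sets"
    "HOL-Library.Poly_Mapping"
    "HOL-Combinatorics.Permutations"
begin

section \<open>Joins of set partitions\<close>

text \<open>\<open>refines A P R\<close> says that \<open>P\<close> is finer than \<open>R\<close>, so this is the finest partition
  coarser than both \<open>P\<close> and \<open>Q\<close>.\<close>

definition join :: "'a set \<Rightarrow> 'a set set \<Rightarrow> 'a set set \<Rightarrow> 'a set set" where
  "join A P Q = (THE R. refines A P R \<and> refines A Q R \<and>
     (\<forall>S. refines A P S \<and> refines A Q S \<longrightarrow> refines A R S))"

lemma join_exists_unique:
  assumes P: "partition_on A P" and Q: "partition_on A Q"
  shows "\<exists>!R. refines A P R \<and> refines A Q R \<and>
     (\<forall>S. refines A P S \<and> refines A Q S \<longrightarrow> refines A R S)"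
proof -
  define U where "U = {S. refines A P S \<and> refines A Q S}"
  define T where "T = {A} - {{}}"
  have T: "partition_on A T"
    unfolding T_def by (cases "A = {}") (auto simp: partition_on_def)
  have coarsest: "refines A S T" if "partition_on A S" for S
    unfolding refines_def using that T by (auto simp: T_def partition_on_def)
  have ne: "U \<noteq> {}" using coarsest[OF P] coarsest[OF Q] by (auto simp: U_def)
  have part: "partition_on A S" if "S \<in> U" for S using that by (simp add: U_def refines_def)
  have "refines A P (common_refinement U)"
    by (rule common_refinement_coarsest[OF part P _ ne]) (simp_all add: U_def)
  moreover have "refines A Q (common_refinement U)"
    by (rule common_refinement_coarsest[OF part Q _ ne]) (simp_all add: U_def)
  moreover have min: "refines A (common_refinement U) S" if "refines A P S \<and> refines A Q S" for S
    by (rule refines_common_refinement[OF part]) (use that in \<open>simp_all add: U_def\<close>)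
  ultimately show ?thesis
    by (intro ex1I[of _ "common_refinement U"] conjI allI impI refines_asym[OF _ min]) auto
qed

lemma join_least:
  assumes "partition_on A P" "partition_on A Q"
  shows "refines A P (join A P Q)" "refines A Q (join A P Q)"
    "refines A P S \<Longrightarrow> refines A Q S \<Longrightarrow> refines A (join A P Q) S"
  using theI'[OF join_exists_unique[OF assms]] unfolding join_def by blast+

lemma refines_card:
  assumes r: "refines A P Q" and fin: "finite A"
  shows "card Q \<le> card P" and "card Q = card P \<Longrightarrow> P = Q"
proof -
  have fP: "finite P" using r fin finite_elements by (auto simp: refines_def)
  obtain g where g: "\<And>X. X \<in> P \<Longrightarrow> g X \<in> Q \<and> X \<subseteq> g X"
    using r unfolding refines_def by metis
  have Pp: "partition_on A P" and Qp: "partition_on A Q" using r by (auto simp: refines_def)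
  have UP: "\<Union>P = A" and UQ: "\<Union>Q = A" using Pp Qp by (auto dest: partition_onD1)
  have gu: "g X = Y" if "X \<in> P" "Y \<in> Q" "x \<in> X" "x \<in> Y" for X Y x
    using g[OF that(1)] that disjointD[OF partition_onD2[OF Qp], of "g X" Y] by blast
  have surj: "g ` P = Q"
  proof
    show "g ` P \<subseteq> Q" using g by auto
    show "Q \<subseteq> g ` P"
    proof
      fix Y assume Y: "Y \<in> Q"
      then obtain x where x: "x \<in> Y" using partition_onD3[OF Qp] by (cases "Y = {}") auto
      then obtain X where "X \<in> P" "x \<in> X" using Y UP UQ by blast
      then show "Y \<in> g ` P" using gu x Y by blast
    qed
  qed
  show "card Q \<le> card P" using surj fP card_image_le by blast
  assume "card Q = card P"
  then have inj: "inj_on g P" using surj fP by (simp add: eq_card_imp_inj_on)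
  have "g X = X" if X: "X \<in> P" for X
  proof
    show "X \<subseteq> g X" using g X by auto
    show "g X \<subseteq> X"
    proof
      fix x assume x: "x \<in> g X"
      then obtain X' where X': "X' \<in> P" "x \<in> X'"
        using g[OF X] UP UQ by blast
      then have "g X' = g X" using gu x g[OF X] by blast
      then show "x \<in> X" using inj X X' by (metis inj_onD)
    qed
  qed
  then have "g ` P = P" by simp
  then show "P = Q" using surj by simp
qed

section \<open>The partitions in $P_k$\<close>

text \<open>The label $i$ is \<open>Inl i\<close>, the label $i'$ is \<open>Inr i\<close>.\<close>

definition labels :: "nat \<Rightarrow> (nat + nat) set" where
  "labels k = {1..k} <+> {1..k}"

lemma finite_labels [simp]: "finite (labels k)"
  by (simp add: labels_def)

text \<open>The disjoint union of all $P_k$.\<close>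

typedef part = "SIGMA k:UNIV. {p. partition_on (labels k) p}"
proof
  show "(0, {}) \<in> (SIGMA k:UNIV. {p. partition_on (labels k) p})"
    by (simp add: labels_def partition_on_def Plus_def)
qed

setup_lifting type_definition_part

lift_definition arity :: "part \<Rightarrow> nat" is fst .
lift_definition blocks :: "part \<Rightarrow> (nat + nat) set set" is snd .

lemma partition_on_blocks: "partition_on (labels (arity p)) (blocks p)"
  by transfer auto

lemma part_eqI: "arity p = arity q \<Longrightarrow> blocks p = blocks q \<Longrightarrow> p = q"
  by transfer (auto simp: prod_eq_iff)

lemma finite_arity: "finite {p. arity p = k}"
proof -
  have inj: "inj_on blocks {p. arity p = k}" by (intro inj_onI part_eqI) auto
  have "blocks ` {p. arity p = k} \<subseteq> {p. partition_on (labels k) p}"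
    using partition_on_blocks by auto
  then have "finite (blocks ` {p. arity p = k})"
    using finitely_many_partition_on[OF finite_labels] finite_subset by blast
  then show ?thesis using inj by (rule finite_imageD)
qed

lift_definition empty_part :: part is "(0, {})"
  by (simp add: labels_def partition_on_def Plus_def)

definition id_blocks :: "nat \<Rightarrow> (nat + nat) set set" where
  "id_blocks k = (\<lambda>i. {Inl i, Inr i}) ` {1..k}"

lift_definition id_part :: "nat \<Rightarrow> part" is "\<lambda>k. (k, id_blocks k)"
  by (fastforce simp: labels_def id_blocks_def partition_on_def disjoint_def)

lemma map_sum_Plus: "map_sum f g ` (A <+> B) = f ` A <+> g ` B"
  by (simp add: Plus_def image_Un image_image)

lemma image_map_sum_labels:
  assumes "partition_on A p" "inj_on f A"
  shows "partition_on (f ` A) ((`) f ` p)"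
proof -
  have "{} \<notin> (`) f ` p" using partition_onD3[OF assms(1)] by auto
  then show ?thesis using partition_on_inj_image[OF assms] by simp
qed

lemma partition_on_permute:
  assumes p: "partition_on (labels k) p" and s: "\<sigma> permutes {1..k}"
  shows "partition_on (labels k) ((`) (map_sum \<sigma> \<sigma>) ` p)"
proof -
  have "inj \<sigma>" using s by (rule permutes_inj)
  then have "inj_on (map_sum \<sigma> \<sigma>) (labels k)"
    by (meson inj_on_subset subset_UNIV sum.inj_map)
  moreover have "map_sum \<sigma> \<sigma> ` labels k = labels k"
    using permutes_image[OF s] by (simp add: labels_def map_sum_Plus)
  ultimately show ?thesis
    using image_map_sum_labels[OF p] by metis
qed

lemma partition_on_tensor:
  assumes p: "partition_on (labels k) p" and q: "partition_on (labels l) q"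
  shows "partition_on (labels (k + l)) (p \<union> (`) (map_sum ((+) k) ((+) k)) ` q)"
proof -
  let ?s = "map_sum ((+) k) ((+) k) :: nat + nat \<Rightarrow> nat + nat"
  have s: "partition_on (?s ` labels l) ((`) ?s ` q)"
    by (rule image_map_sum_labels[OF q]) (rule inj_on_subset[OF sum.inj_map], auto)
  have disj: "labels k \<inter> ?s ` labels l = {}"
    by (auto simp: labels_def)
  have "(+) k ` {1..l} = {k+1..k+l}" by (simp add: add.commute)
  then have s_labels: "?s ` labels l = {k+1..k+l} <+> {k+1..k+l}"
    by (simp only: labels_def map_sum_Plus)
  have un: "labels (k + l) = labels k \<union> ?s ` labels l"
    unfolding s_labels
  proof (rule set_eqI)
    fix x show "x \<in> labels (k + l) \<longleftrightarrow> x \<in> labels k \<union> ({k+1..k+l} <+> {k+1..k+l})"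
      by (cases x) (auto simp: labels_def)
  qed
  show ?thesis
  proof (rule partition_onI)
    show "\<Union> (p \<union> (`) ?s ` q) = labels (k + l)"
      by (simp only: un Union_Un_distrib partition_onD1[OF p, symmetric] partition_onD1[OF s, symmetric])
    show "{} \<notin> p \<union> (`) ?s ` q" using partition_onD3[OF p] partition_onD3[OF s] by (simp only: Un_iff not_False_eq_True disj_not1 simp_thms)
    fix X Y assume XY: "X \<in> p \<union> (`) ?s ` q" "Y \<in> p \<union> (`) ?s ` q" "X \<noteq> Y"
    have sub: "Z \<subseteq> labels k" if "Z \<in> p" for Z using that partition_onD1[OF p] by blast
    have sub': "Z \<subseteq> ?s ` labels l" if "Z \<in> (`) ?s ` q" for Z
      using that partition_onD1[OF s] by blast
    have "disjnt X Y" if "X \<in> p" "Y \<in> p"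
      using pairwiseD[OF partition_onD2[OF p] that XY(3)] .
    moreover have "disjnt X Y" if "X \<in> (`) ?s ` q" "Y \<in> (`) ?s ` q"
      using pairwiseD[OF partition_onD2[OF s] that XY(3)] .
    moreover have "disjnt X Y" if "X \<in> p" "Y \<in> (`) ?s ` q"
      using sub[OF that(1)] sub'[OF that(2)] disj unfolding disjnt_def by blast
    moreover have "disjnt X Y" if "Y \<in> p" "X \<in> (`) ?s ` q"
      using sub[OF that(1)] sub'[OF that(2)] disj unfolding disjnt_def by blast
    ultimately show "disjnt X Y" using XY(1,2) by (meson UnE)
  qed
qed

text \<open>A permutation of \<open>{1..k}\<close> acts on unprimed and primed labels simultaneously.
  The operation is used only for permutations of \<open>{1..arity p}\<close>; for all other
  functions the partition is left unchanged, to make it total.\<close>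

lift_definition permute :: "(nat \<Rightarrow> nat) \<Rightarrow> part \<Rightarrow> part" is
  "\<lambda>\<sigma> (k, p). (k, if \<sigma> permutes {1..k} then (`) (map_sum \<sigma> \<sigma>) ` p else p)"
  using partition_on_permute by (auto simp del: One_nat_def)

lift_definition tensor :: "part \<Rightarrow> part \<Rightarrow> part" is
  "\<lambda>(k, p) (l, q). (k + l, p \<union> (`) (map_sum ((+) k) ((+) k)) ` q)"
  using partition_on_tensor by auto

section \<open>Distance and orders\<close>

abbreviation nc :: "(nat + nat) set set \<Rightarrow> nat" where
  "nc \<equiv> card"

definition nc_join :: "part \<Rightarrow> part \<Rightarrow> nat" where
  "nc_join p q = nc (join (labels (arity p)) (blocks p) (blocks q))"

definition coarser :: "part \<Rightarrow> part \<Rightarrow> bool" where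
  "coarser p' p \<longleftrightarrow> arity p' = arity p \<and> refines (labels (arity p)) (blocks p) (blocks p')"

definition pdist :: "part \<Rightarrow> part \<Rightarrow> real" where
  "pdist p q = (real (nc (blocks p)) + real (nc (blocks q))) / 2 - real (nc_join p q)"

definition geod_le :: "part \<Rightarrow> part \<Rightarrow> bool" where
  "geod_le p' p \<longleftrightarrow> arity p' = arity p \<and>
     pdist (id_part (arity p)) p' + pdist p' p = pdist (id_part (arity p)) p"

text \<open>In the next two definitions \<open>p'\<close> is coarser, respectively finer, than \<open>p\<close>.\<close>

definition dashv_le :: "part \<Rightarrow> part \<Rightarrow> bool" where
  "dashv_le p' p \<longleftrightarrow> coarser p' p \<and>
     nc_join p' (id_part (arity p)) = nc_join p (id_part (arity p))"

definition sqsup_le :: "part \<Rightarrow> part \<Rightarrow> bool" where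
  "sqsup_le p' p \<longleftrightarrow> coarser p p' \<and>
     int (nc (blocks p')) - int (nc_join p' (id_part (arity p))) =
     int (nc (blocks p)) - int (nc_join p (id_part (arity p)))"

section \<open>Linear forms and transforms\<close>

text \<open>\<open>part \<Rightarrow>\<^sub>0 complex\<close> is the direct sum of the spaces $C[P_k]$, with basis
  \<open>basis p\<close>.\<close>

abbreviation basis :: "part \<Rightarrow> (part \<Rightarrow>\<^sub>0 complex)" where
  "basis p \<equiv> Poly_Mapping.single p 1"

abbreviation scale :: "complex \<Rightarrow> (part \<Rightarrow>\<^sub>0 complex) \<Rightarrow> (part \<Rightarrow>\<^sub>0 complex)" where
  "scale c \<equiv> Poly_Mapping.map ((*) c)"

lemma lookup_scale: "Poly_Mapping.lookup (scale c x) p = c * Poly_Mapping.lookup x p"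
  by (simp add: Poly_Mapping.map.rep_eq when_def)

lemma vector_space_scale: "vector_space scale"
  by unfold_locales (auto intro!: poly_mapping_eqI simp: lookup_scale lookup_add algebra_simps)

lemma vector_space_complex: "vector_space ((*) :: complex \<Rightarrow> complex \<Rightarrow> complex)"
  by unfold_locales (auto simp: algebra_simps)

definition linear_forms :: "((part \<Rightarrow>\<^sub>0 complex) \<Rightarrow> complex) set" where
  "linear_forms = {\<phi>. Vector_Spaces.linear scale (*) \<phi>}"

text \<open>Linear forms on the direct sum of the $C[P_k/S_k]$, identified with the linear
  forms on the direct sum of the $C[P_k]$ that are invariant under all the symmetric
  groups; by linearity, invariance is only required on the basis.\<close>

definition invariant_forms :: "((part \<Rightarrow>\<^sub>0 complex) \<Rightarrow> complex) set" where
  "invariant_forms = {\<phi> \<in> linear_forms.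
     \<forall>p \<sigma>. \<sigma> permutes {1..arity p} \<longrightarrow> \<phi> (basis (permute \<sigma> p)) = \<phi> (basis p)}"

definition characters :: "((part \<Rightarrow>\<^sub>0 complex) \<Rightarrow> complex) set" where
  "characters = {\<phi> \<in> invariant_forms. \<phi> (basis empty_part) = 1 \<and>
     (\<forall>p q. \<phi> (basis (tensor p q)) = \<phi> (basis p) * \<phi> (basis q))}"

text \<open>The unique linear form with prescribed values on the basis.\<close>

definition extend :: "(part \<Rightarrow> complex) \<Rightarrow> (part \<Rightarrow>\<^sub>0 complex) \<Rightarrow> complex" where
  "extend f x = (\<Sum>p\<in>Poly_Mapping.keys x. Poly_Mapping.lookup x p * f p)"

definition M_transform ::
    "((part \<Rightarrow>\<^sub>0 complex) \<Rightarrow> complex) \<Rightarrow> (part \<Rightarrow>\<^sub>0 complex) \<Rightarrow> complex" where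
  "M_transform \<phi> = extend (\<lambda>p. \<Sum>p' | geod_le p' p. \<phi> (basis p'))"

definition Mtoc_transform ::
    "((part \<Rightarrow>\<^sub>0 complex) \<Rightarrow> complex) \<Rightarrow> (part \<Rightarrow>\<^sub>0 complex) \<Rightarrow> complex" where
  "Mtoc_transform \<phi> = extend (\<lambda>p. \<Sum>p' | sqsup_le p' p. \<phi> (basis p'))"

definition Mcto_transform ::
    "((part \<Rightarrow>\<^sub>0 complex) \<Rightarrow> complex) \<Rightarrow> (part \<Rightarrow>\<^sub>0 complex) \<Rightarrow> complex" where
  "Mcto_transform \<phi> = extend (\<lambda>p. \<Sum>p' | dashv_le p' p. \<phi> (basis p'))"

text \<open>The inverse of \<open>M_transform\<close> on \<open>linear_forms\<close>; it is a genuine two-sided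
  inverse by \<open>bij_betw_M_transform\<close> below.\<close>

definition R_transform ::
    "((part \<Rightarrow>\<^sub>0 complex) \<Rightarrow> complex) \<Rightarrow> (part \<Rightarrow>\<^sub>0 complex) \<Rightarrow> complex" where
  "R_transform = inv_into linear_forms M_transform"

lemma extend_basis [simp]: "extend f (basis p) = f p"
  by (simp add: extend_def)

lemma extend_superset:
  assumes "finite K" "Poly_Mapping.keys x \<subseteq> K"
  shows "extend f x = (\<Sum>p\<in>K. Poly_Mapping.lookup x p * f p)"
  unfolding extend_def by (rule sum.mono_neutral_left) (use assms in \<open>auto simp: in_keys_iff\<close>)

lemma extend_linear: "extend f \<in> linear_forms"
proof -
  have "extend f (x + y) = extend f x + extend f y" for x y
  proof -
    have K: "finite (Poly_Mapping.keys x \<union> Poly_Mapping.keys y)" by simp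
    show ?thesis
      using extend_superset[OF K, of x f] extend_superset[OF K, of y f]
        extend_superset[OF K keys_add, of f]
      by (simp add: lookup_add algebra_simps sum.distrib)
  qed
  moreover have "extend f (scale c x) = c * extend f x" for c x
  proof -
    have "Poly_Mapping.keys (scale c x) \<subseteq> Poly_Mapping.keys x" by (auto simp: in_keys_iff lookup_scale)
    then show ?thesis
      using extend_superset[of "Poly_Mapping.keys x" "scale c x" f]
      by (simp add: extend_def lookup_scale sum_distrib_left mult.assoc)
  qed
  ultimately show ?thesis
    unfolding linear_forms_def Vector_Spaces.linear_def
    by (auto simp: vector_space_scale vector_space_complex module_hom_def module_hom_axioms_def
        module_iff_vector_space)
qed

lemma linear_form_extend:
  assumes "\<phi> \<in> linear_forms"
  shows "\<phi> = extend (\<lambda>p. \<phi> (basis p))"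
proof
  fix x
  interpret Vector_Spaces.linear scale "(*)" \<phi> using assms by (simp add: linear_forms_def)
  have "x = (\<Sum>p\<in>Poly_Mapping.keys x. scale (Poly_Mapping.lookup x p) (basis p))"
    by (rule poly_mapping_eqI)
       (auto simp: lookup_sum lookup_scale lookup_single when_def in_keys_iff if_distrib cong: if_cong)
  then have "\<phi> x = \<phi> (\<Sum>p\<in>Poly_Mapping.keys x. scale (Poly_Mapping.lookup x p) (basis p))" by simp
  then show "\<phi> x = extend (\<lambda>p. \<phi> (basis p)) x"
    by (simp only: sum local.scale extend_def)
qed

lemma bij_betw_extend_sum:
  assumes wf: "wf r" and fin: "\<And>p. finite {p'. le p' p}" and le_refl: "\<And>p. le p p"
    and r: "\<And>p p'. le p' p \<Longrightarrow> p' \<noteq> p \<Longrightarrow> (p', p) \<in> r"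
  shows "bij_betw (\<lambda>\<phi>. extend (\<lambda>p. \<Sum>p' | le p' p. \<phi> (basis p'))) linear_forms linear_forms"
proof -
  have split: "(\<Sum>p' | le p' p. f p') = f p + (\<Sum>p' | le p' p \<and> p' \<noteq> p. f p')"
    for f :: "part \<Rightarrow> complex" and p
  proof -
    have "{p'. le p' p} = insert p {p'. le p' p \<and> p' \<noteq> p}" using le_refl by auto
    moreover have "finite {p'. le p' p \<and> p' \<noteq> p}" by (rule finite_subset[OF _ fin[of p]]) auto
    ultimately show ?thesis by simp
  qed
  have inj: "inj_on (\<lambda>\<phi>. extend (\<lambda>p. \<Sum>p' | le p' p. \<phi> (basis p'))) linear_forms"
  proof (rule inj_onI)
    fix \<phi> \<psi> assume lin: "\<phi> \<in> linear_forms" "\<psi> \<in> linear_forms"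
      and eq: "extend (\<lambda>p. \<Sum>p' | le p' p. \<phi> (basis p')) = extend (\<lambda>p. \<Sum>p' | le p' p. \<psi> (basis p'))"
    have "\<phi> (basis p) = \<psi> (basis p)" for p
      using wf
    proof (induction p)
      case (less p)
      have "(\<Sum>p' | le p' p \<and> p' \<noteq> p. \<phi> (basis p')) = (\<Sum>p' | le p' p \<and> p' \<noteq> p. \<psi> (basis p'))"
        by (rule sum.cong) (use less r in auto)
      moreover have "(\<Sum>p' | le p' p. \<phi> (basis p')) = (\<Sum>p' | le p' p. \<psi> (basis p'))"
        using fun_cong[OF eq, of "basis p"] by simp
      ultimately show ?case by (simp add: split)
    qed
    then show "\<phi> = \<psi>" using linear_form_extend[OF lin(1)] linear_form_extend[OF lin(2)] by simp
  qed
  have surj: "\<exists>\<phi>\<in>linear_forms. extend (\<lambda>p. \<Sum>p' | le p' p. \<phi> (basis p')) = \<psi>"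
    if lin: "\<psi> \<in> linear_forms" for \<psi>
  proof -
    define H where "H = (\<lambda>(f :: part \<Rightarrow> complex) p. \<psi> (basis p) - (\<Sum>p' | le p' p \<and> p' \<noteq> p. f p'))"
    define f where "f = wfrec r H"
    have f: "f p = H f p" for p
    proof -
      have "f p = H (cut f r p) p" unfolding f_def by (rule wfrec[OF wf])
      also have "\<dots> = H f p"
        unfolding H_def by (intro arg_cong2[where f = minus] refl sum.cong) (auto simp: cut_apply r)
      finally show ?thesis .
    qed
    have "(\<Sum>p' | le p' p. f p') = \<psi> (basis p)" for p
      using f[of p] by (simp add: split H_def)
    then have "extend (\<lambda>p. \<Sum>p' | le p' p. extend f (basis p')) = \<psi>"
      using linear_form_extend[OF lin] by simp
    then show ?thesis using extend_linear by blast
  qed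
  show ?thesis
    unfolding bij_betw_def using inj surj extend_linear by auto
qed

lemma nc_join_le:
  assumes "arity p = arity q"
  shows "nc_join p q \<le> nc (blocks p)" "nc_join p q \<le> nc (blocks q)"
    "nc_join p q = nc (blocks p) \<Longrightarrow> nc_join p q = nc (blocks q) \<Longrightarrow> p = q"
proof -
  note J = join_least(1,2)[OF partition_on_blocks[of p] partition_on_blocks[of q, folded assms]]
  note C = refines_card[OF J(1) finite_labels] refines_card[OF J(2) finite_labels]
  show "nc_join p q \<le> nc (blocks p)" "nc_join p q \<le> nc (blocks q)"
    using C by (auto simp: nc_join_def)
  assume "nc_join p q = nc (blocks p)" "nc_join p q = nc (blocks q)"
  then have "blocks p = blocks q" using C unfolding nc_join_def by metis
  then show "p = q" using assms by (intro part_eqI)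
qed

lemma pdist_nonneg: "arity p = arity q \<Longrightarrow> 0 \<le> pdist p q"
  using nc_join_le(1,2)[of p q] by (simp add: pdist_def)

lemma pdist_pos: "arity p = arity q \<Longrightarrow> p \<noteq> q \<Longrightarrow> 0 < pdist p q"
proof -
  assume a: "arity p = arity q" "p \<noteq> q"
  have "nc_join p q < nc (blocks p) \<or> nc_join p q < nc (blocks q)"
    using nc_join_le[OF a(1)] a(2) by (metis le_neq_implies_less)
  then show ?thesis using nc_join_le(1,2)[OF a(1)] by (auto simp: pdist_def)
qed

lemma arity_id_part [simp]: "arity (id_part k) = k"
  by transfer simp

lemma join_self: "partition_on A P \<Longrightarrow> join A P P = P"
  by (meson join_least refines_asym refines_refl)

theorem bij_betw_M_transform: "bij_betw M_transform linear_forms linear_forms"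
  unfolding M_transform_def
proof (rule bij_betw_extend_sum)
  let ?h = "\<lambda>p. nat \<lfloor>2 * pdist (id_part (arity p)) p\<rfloor>"
  show "wf (measure ?h)" by simp
  show "finite {p'. geod_le p' p}" for p
    by (rule finite_subset[OF _ finite_arity[of "arity p"]]) (auto simp: geod_le_def)
  show "geod_le p p" for p
    using join_self[OF partition_on_blocks[of p]] by (simp add: geod_le_def pdist_def nc_join_def)
  fix p p' assume le: "geod_le p' p" and "p' \<noteq> p"
  have a: "arity p' = arity p" using le by (simp add: geod_le_def)
  have int: "\<exists>z. 2 * pdist x y = real_of_int z" for x y
    by (rule exI[of _ "int (nc (blocks x)) + int (nc (blocks y)) - 2 * int (nc_join x y)"])
       (simp add: pdist_def)
  have "pdist (id_part (arity p')) p' < pdist (id_part (arity p)) p"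
    using le pdist_pos[OF a \<open>p' \<noteq> p\<close>] a by (simp add: geod_le_def)
  moreover have "0 \<le> pdist (id_part (arity p')) p'" by (rule pdist_nonneg) simp
  moreover obtain z z' where "2 * pdist (id_part (arity p)) p = real_of_int z"
    "2 * pdist (id_part (arity p')) p' = real_of_int z'" using int by metis
  ultimately show "(p', p) \<in> measure ?h" by simp
qed

end

theory Submission
  imports Defs
begin

text \<open>The unions of blocks of a partition \<open>p\<close> form a group \<open>S p\<close> under symmetric difference, with
  \<open>2 ^ nc p\<close> elements; the join of partitions corresponds to the intersection of groups, and \<open>p'\<close>
  is coarser than \<open>p\<close> iff \<open>S p' \<subseteq> S p\<close>. In these terms \<open>p' \<le> p\<close> is the equality case of
  \<open>|S p' \<inter> S id| |S p' \<inter> S p| \<le> |S p'| |S p' \<inter> S id \<inter> S p| \<le> |S p'| |S p \<inter> S id|\<close>,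
  and the two other orders are its intersections with ``coarser'' and ``finer''. Equality forces
  \<open>S p \<inter> S id \<subseteq> S p'\<close>; if \<open>p = p1 \<otimes> p2\<close>, the set of labels of \<open>p1\<close> lies in the left-hand side,
  so \<open>p'\<close> is a tensor product too. Hence the down-set of \<open>p1 \<otimes> p2\<close> is the product of those of
  \<open>p1\<close> and \<open>p2\<close>, so that the transforms preserve multiplicativity, and so do their inverses by
  induction along the order.\<close>

section \<open>Unions of blocks\<close>

text \<open>This is the group \<open>S p\<close> of the overview. The ground set does not appear in
  it and enters only through \<open>in_saturated_iff\<close>.\<close>

definition saturated :: "'a set set \<Rightarrow> 'a set set" where
  "saturated P = Union ` Pow P"

lemma empty_in_saturated [simp]: "{} \<in> saturated P"
  unfolding saturated_def by blast

lemma finite_saturated: "finite P \<Longrightarrow> finite (saturated P)"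
  by (simp add: saturated_def)

text \<open>Blocks are disjoint, so a union of blocks contains or misses each block; conversely such
  a set is the union of the blocks inside it.\<close>

lemma in_saturated_iff:
  assumes "partition_on A P"
  shows "U \<in> saturated P \<longleftrightarrow> U \<subseteq> A \<and> (\<forall>B\<in>P. B \<subseteq> U \<or> B \<inter> U = {})"
proof
  assume "U \<in> saturated P"
  then obtain Z where Z: "Z \<subseteq> P" "U = \<Union>Z" by (auto simp: saturated_def)
  then have "B \<subseteq> U \<or> B \<inter> U = {}" if "B \<in> P" for B
    using that disjointD[OF partition_onD2[OF assms] that] by blast
  moreover have "U \<subseteq> A" using Z partition_onD1[OF assms] by blast
  ultimately show "U \<subseteq> A \<and> (\<forall>B\<in>P. B \<subseteq> U \<or> B \<inter> U = {})" by blast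
next
  assume U: "U \<subseteq> A \<and> (\<forall>B\<in>P. B \<subseteq> U \<or> B \<inter> U = {})"
  have "U \<subseteq> \<Union>{B \<in> P. B \<subseteq> U}"
  proof
    fix x assume x: "x \<in> U"
    then obtain B where "B \<in> P" "x \<in> B" using U partition_onD1[OF assms] by blast
    moreover from this have "B \<subseteq> U" using U x by auto
    ultimately show "x \<in> \<Union>{B \<in> P. B \<subseteq> U}" by blast
  qed
  then have "U = \<Union>{B \<in> P. B \<subseteq> U}" by blast
  then show "U \<in> saturated P" unfolding saturated_def by blast
qed

text \<open>Blocks are nonempty and disjoint, so a family of blocks is recovered from its union as
  the blocks contained in it.\<close>

lemma card_saturated:
  assumes "partition_on A P" "finite A"
  shows "card (saturated P) = 2 ^ card P"
proof -
  have "Z = {B \<in> P. B \<subseteq> \<Union>Z}" if "Z \<subseteq> P" for Z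
  proof
    show "{B \<in> P. B \<subseteq> \<Union>Z} \<subseteq> Z"
    proof
      fix B assume B: "B \<in> {B \<in> P. B \<subseteq> \<Union>Z}"
      then obtain x where "x \<in> B" using partition_onD3[OF assms(1)] by (cases "B = {}") auto
      then obtain C where "C \<in> Z" "x \<in> C" using B by blast
      then have "B = C"
        using B \<open>x \<in> B\<close> that disjointD[OF partition_onD2[OF assms(1)], of B C] by blast
      then show "B \<in> Z" using \<open>C \<in> Z\<close> by simp
    qed
  qed (use that in blast)
  then have "inj_on Union (Pow P)" by (intro inj_onI) (metis PowD)
  then show ?thesis
    using finite_elements[OF assms(2,1)] by (simp add: saturated_def card_image card_Pow)
qed

lemma saturated_sym_diff:
  assumes "partition_on A P" "U \<in> saturated P" "V \<in> saturated P"
  shows "sym_diff U V \<in> saturated P"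
proof -
  note iff = in_saturated_iff[OF assms(1)]
  have "B \<subseteq> sym_diff U V \<or> B \<inter> sym_diff U V = {}" if "B \<in> P" for B
  proof -
    have "B \<subseteq> U \<or> B \<inter> U = {}" "B \<subseteq> V \<or> B \<inter> V = {}" using assms(2,3) that by (auto simp: iff)
    then show ?thesis by (elim disjE) blast+
  qed
  then show ?thesis using assms(2,3) by (auto simp: iff)
qed

text \<open>For the converse, a block \<open>C\<close> of \<open>Q\<close> is itself saturated,
  hence saturated for \<open>P\<close>, so every block of \<open>P\<close> that meets
  \<open>C\<close> lies in \<open>C\<close>.\<close>

lemma refines_iff_saturated:
  assumes P: "partition_on A P" and Q: "partition_on A Q"
  shows "refines A P Q \<longleftrightarrow> saturated Q \<subseteq> saturated P"
proof
  assume r: "refines A P Q"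
  show "saturated Q \<subseteq> saturated P"
  proof
    fix U assume U: "U \<in> saturated Q"
    have "B \<subseteq> U \<or> B \<inter> U = {}" if B: "B \<in> P" for B
    proof -
      have "\<forall>B\<in>P. \<exists>C\<in>Q. B \<subseteq> C" using r by (simp add: refines_def)
      then obtain C where C: "C \<in> Q" "B \<subseteq> C" using B by auto
      then have "C \<subseteq> U \<or> C \<inter> U = {}" using U by (simp add: in_saturated_iff[OF Q])
      then show ?thesis using C(2) by blast
    qed
    then show "U \<in> saturated P" using U by (simp add: in_saturated_iff[OF P] in_saturated_iff[OF Q])
  qed
next
  assume sub: "saturated Q \<subseteq> saturated P"
  have "\<exists>C\<in>Q. B \<subseteq> C" if B: "B \<in> P" for B
  proof -
    obtain x where x: "x \<in> B" using partition_onD3[OF P] B by (cases "B = {}") auto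
    then obtain C where C: "C \<in> Q" "x \<in> C"
      using B partition_onD1[OF P] partition_onD1[OF Q] by (metis UnionE UnionI)
    have "C \<in> saturated Q" unfolding saturated_def by (rule image_eqI[where x = "{C}"]) (use C(1) in auto)
    then have "C \<in> saturated P" using sub by blast
    then have "B \<subseteq> C \<or> B \<inter> C = {}" using B by (simp add: in_saturated_iff[OF P])
    then have "B \<subseteq> C" using x C(2) by blast
    then show ?thesis using C(1) by blast
  qed
  then show "refines A P Q" using P Q by (simp add: refines_def)
qed

text \<open>A set \<open>U\<close> saturated for both \<open>P\<close> and \<open>Q\<close> is saturated for the join because the
  partition into \<open>U\<close> and its complement is coarser than both.\<close>

lemma saturated_join:
  assumes P: "partition_on A P" and Q: "partition_on A Q"
  shows "saturated (join A P Q) = saturated P \<inter> saturated Q"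
proof -
  note J = join_least[OF P Q]
  have Jp: "partition_on A (join A P Q)" using J(1) by (simp add: refines_def)
  show ?thesis
  proof
    show "saturated (join A P Q) \<subseteq> saturated P \<inter> saturated Q"
      using J(1,2) refines_iff_saturated[OF P Jp] refines_iff_saturated[OF Q Jp] by blast
    show "saturated P \<inter> saturated Q \<subseteq> saturated (join A P Q)"
    proof
      fix U assume U: "U \<in> saturated P \<inter> saturated Q"
      \<comment> \<open>Removing \<open>{}\<close> covers the cases \<open>U = {}\<close> and
        \<open>U = A\<close>.\<close>
      define S where "S = {U, A - U} - {{}}"
      have UA: "U \<subseteq> A" using U by (auto simp: in_saturated_iff[OF P])
      have S: "partition_on A S"
        using UA by (auto simp: S_def partition_on_def disjoint_def)
      have refS: "refines A R S" if R: "partition_on A R" and UR: "U \<in> saturated R" for R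
      proof -
        have "\<exists>C\<in>S. B \<subseteq> C" if B: "B \<in> R" for B
        proof -
          have "B \<noteq> {}" "B \<subseteq> A" using B partition_onD1[OF R] partition_onD3[OF R] by auto
          moreover have "B \<subseteq> U \<or> B \<inter> U = {}" using UR B by (simp add: in_saturated_iff[OF R])
          ultimately show ?thesis unfolding S_def by blast
        qed
        then show ?thesis using R S by (simp add: refines_def)
      qed
      have "refines A (join A P Q) S" using U refS P Q by (intro J(3)) auto
      then have "saturated S \<subseteq> saturated (join A P Q)" by (simp add: refines_iff_saturated[OF Jp S])
      moreover have "U \<in> saturated S" unfolding in_saturated_iff[OF S] using UA by (auto simp: S_def)
      ultimately show "U \<in> saturated (join A P Q)" by blast
    qed
  qed
qed

lemma saturated_image: "saturated ((`) f ` P) = (`) f ` saturated P"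
proof -
  have "Union ` Pow ((`) f ` P) = Union ` ((`) ((`) f) ` Pow P)"
    by (simp add: image_Pow_surj)
  also have "\<dots> = (`) f ` (Union ` Pow P)"
    by (simp add: image_image image_Union)
  finally show ?thesis by (simp add: saturated_def)
qed

lemma saturated_Un: "saturated (P \<union> Q) = (\<lambda>(U, V). U \<union> V) ` (saturated P \<times> saturated Q)"
proof
  show "saturated (P \<union> Q) \<subseteq> (\<lambda>(U, V). U \<union> V) ` (saturated P \<times> saturated Q)"
  proof
    fix U assume "U \<in> saturated (P \<union> Q)"
    then obtain Z where Z: "Z \<subseteq> P \<union> Q" "U = \<Union>Z" by (auto simp: saturated_def)
    then have "U = \<Union>(Z \<inter> P) \<union> \<Union>(Z \<inter> Q)" by blast
    then show "U \<in> (\<lambda>(U, V). U \<union> V) ` (saturated P \<times> saturated Q)"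
      unfolding saturated_def by (intro image_eqI[where x = "(\<Union>(Z \<inter> P), \<Union>(Z \<inter> Q))"]) auto
  qed
  have "\<Union>Y \<union> \<Union>Z \<in> saturated (P \<union> Q)" if "Y \<subseteq> P" "Z \<subseteq> Q" for Y Z
    unfolding saturated_def by (rule image_eqI[where x = "Y \<union> Z"]) (use that in auto)
  then show "(\<lambda>(U, V). U \<union> V) ` (saturated P \<times> saturated Q) \<subseteq> saturated (P \<union> Q)"
    by (auto simp: saturated_def)
qed

text \<open>The product formula for the subgroups \<open>G \<inter> X\<close> and \<open>G \<inter> Y\<close> of the group \<open>G\<close>: the fibres
  of \<open>(U, V) \<mapsto> sym_diff U V\<close> are cosets of \<open>G \<inter> X \<inter> Y\<close>.\<close>

lemma card_sym_diff_closed: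
  assumes fin: "finite G"
    and G: "\<And>U V. U \<in> G \<Longrightarrow> V \<in> G \<Longrightarrow> sym_diff U V \<in> G"
    and X: "\<And>U V. U \<in> X \<Longrightarrow> V \<in> X \<Longrightarrow> sym_diff U V \<in> X"
    and Y: "\<And>U V. U \<in> Y \<Longrightarrow> V \<in> Y \<Longrightarrow> sym_diff U V \<in> Y"
  shows "card (G \<inter> X) * card (G \<inter> Y) \<le> card G * card (G \<inter> X \<inter> Y)"
proof -
  define D where "D = (G \<inter> X) \<times> (G \<inter> Y)"
  \<comment> \<open>A chosen representative of the fibre over \<open>W\<close>.\<close>
  define s where "s W = (SOME z. z \<in> D \<and> sym_diff (fst z) (snd z) = W)" for W
  have s: "s (sym_diff (fst z) (snd z)) \<in> D \<and>
      sym_diff (fst (s (sym_diff (fst z) (snd z)))) (snd (s (sym_diff (fst z) (snd z)))) =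
      sym_diff (fst z) (snd z)" if "z \<in> D" for z
    unfolding s_def by (rule someI[where x = z]) (simp add: that)
  \<comment> \<open>A pair is encoded by its difference and by its displacement from the
    representative of its fibre, measured in the first component.\<close>
  define g where "g z = (sym_diff (fst z) (snd z), sym_diff (fst z) (fst (s (sym_diff (fst z) (snd z)))))" for z
  have inj: "inj_on g D"
  proof (rule inj_onI)
    fix z z' assume eq: "g z = g z'"
    then have "sym_diff (fst z) (snd z) = sym_diff (fst z') (snd z')" by (simp add: g_def)
    moreover from this eq have "fst z = fst z'" by (simp add: g_def) blast
    ultimately have "snd z = snd z'" by blast
    then show "z = z'" using \<open>fst z = fst z'\<close> by (simp add: prod_eq_iff)
  qed
  have "g z \<in> G \<times> (G \<inter> X \<inter> Y)" if z: "z \<in> D" for z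
  proof -
    define W where "W = sym_diff (fst z) (snd z)"
    have sW: "s W \<in> D" "sym_diff (fst (s W)) (snd (s W)) = sym_diff (fst z) (snd z)"
      using s[OF z] unfolding W_def by auto
    \<comment> \<open>The displacement is the same in both components, which places it in
      \<open>X\<close> and in \<open>Y\<close>.\<close>
    have "sym_diff (fst z) (fst (s W)) = sym_diff (snd z) (snd (s W))" using sW(2) by blast
    moreover have "sym_diff (snd z) (snd (s W)) \<in> Y" using z sW(1) Y by (auto simp: D_def)
    moreover have "sym_diff (fst z) (fst (s W)) \<in> G \<inter> X"
      using z sW(1) by (auto simp: D_def intro: G X)
    moreover have "W \<in> G" using z by (auto simp: D_def W_def intro: G)
    ultimately show ?thesis unfolding g_def W_def by auto
  qed
  then have "card D \<le> card (G \<times> (G \<inter> X \<inter> Y))"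
    using fin by (intro card_inj_on_le[OF inj] image_subsetI) auto
  then show ?thesis by (simp add: D_def card_cartesian_product)
qed

section \<open>The three orders in terms of cardinalities of groups\<close>

abbreviation sat :: "part \<Rightarrow> (nat + nat) set set" where
  "sat p \<equiv> saturated (blocks p)"

lemma finite_sat [simp]: "finite (sat p)"
  by (rule finite_saturated[OF finite_elements[OF finite_labels partition_on_blocks]])

lemma sat_subset: "sat p \<subseteq> Pow (labels (arity p))"
  using in_saturated_iff[OF partition_on_blocks[of p]] by blast

lemma card_sat: "card (sat p) = 2 ^ nc (blocks p)"
  by (rule card_saturated[OF partition_on_blocks finite_labels])

lemma card_sat_Int:
  assumes "arity p = arity q"
  shows "card (sat p \<inter> sat q) = 2 ^ nc_join p q"
proof -
  note J = partition_on_blocks[of p] partition_on_blocks[of q, folded assms]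
  have "partition_on (labels (arity p)) (join (labels (arity p)) (blocks p) (blocks q))"
    using join_least(1)[OF J] by (simp add: refines_def)
  from card_saturated[OF this finite_labels] show ?thesis
    by (simp add: saturated_join[OF J] nc_join_def)
qed

lemma coarser_iff: "coarser p' p \<longleftrightarrow> arity p' = arity p \<and> sat p' \<subseteq> sat p"
proof (cases "arity p' = arity p")
  case True
  note iff = refines_iff_saturated[OF partition_on_blocks[of p] partition_on_blocks[of p', unfolded True]]
  show ?thesis by (simp add: coarser_def iff True)
qed (simp add: coarser_def)

text \<open>The block counts of \<open>p\<close> and of the identity cancel in the sum of distances.
  What remains is an additive identity between block counts, whose powers of 2 are the stated
  cardinalities.\<close>

lemma geod_le_iff:
  "geod_le p' p \<longleftrightarrow> arity p' = arity p \<and>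
     card (sat p') * card (sat p \<inter> sat (id_part (arity p))) =
     card (sat p' \<inter> sat (id_part (arity p))) * card (sat p' \<inter> sat p)"
proof (cases "arity p' = arity p")
  case True
  let ?i = "id_part (arity p)"
  have comm: "nc_join ?i q = nc_join q ?i" if "arity q = arity p" for q
    using card_sat_Int[of ?i q] card_sat_Int[of q ?i] that by (simp add: Int_commute)
  have "geod_le p' p \<longleftrightarrow> nc (blocks p') + nc_join p ?i = nc_join p' ?i + nc_join p' p"
    using True comm[of p] comm[of p'] by (auto simp: geod_le_def pdist_def field_simps)
  also have "\<dots> \<longleftrightarrow> (2::nat) ^ (nc (blocks p') + nc_join p ?i) = 2 ^ (nc_join p' ?i + nc_join p' p)"
    by simp
  finally show ?thesis using True by (simp add: card_sat card_sat_Int power_add)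
qed (simp add: geod_le_def)

lemma card_sat_Int_mult_le_Int:
  "card (sat p \<inter> sat r) * card (sat p \<inter> sat q) \<le> card (sat p) * card (sat p \<inter> sat r \<inter> sat q)"
  by (rule card_sym_diff_closed[OF finite_sat saturated_sym_diff saturated_sym_diff saturated_sym_diff])
     (rule partition_on_blocks | assumption)+

text \<open>For equal arities this is the triangle inequality for \<open>pdist\<close> from
  \<open>r\<close> to \<open>q\<close> through \<open>p\<close>, in multiplicative form.\<close>

lemma card_sat_Int_mult_le:
  "card (sat p \<inter> sat r) * card (sat p \<inter> sat q) \<le> card (sat p) * card (sat q \<inter> sat r)"
proof -
  have "card (sat p \<inter> sat r \<inter> sat q) \<le> card (sat q \<inter> sat r)"
    by (rule card_mono) auto
  then show ?thesis using card_sat_Int_mult_le_Int[of p r q] by (meson le_trans mult_le_mono2)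
qed

text \<open>If \<open>p'\<close> is coarser, then \<open>sat p' \<inter> sat p = sat p'\<close>, and
  the nonzero factor \<open>card (sat p')\<close> cancels from \<open>geod_le_iff\<close>.\<close>

lemma dashv_le_iff: "dashv_le p' p \<longleftrightarrow> geod_le p' p \<and> coarser p' p"
proof (cases "coarser p' p")
  case True
  then have a: "arity p' = arity p" and sub: "sat p' \<inter> sat p = sat p'" by (auto simp: coarser_iff)
  have "card (sat p') \<noteq> 0" by (simp add: card_sat)
  then have "geod_le p' p \<longleftrightarrow>
      card (sat p \<inter> sat (id_part (arity p))) = card (sat p' \<inter> sat (id_part (arity p)))"
    using a by (auto simp: geod_le_iff sub)
  then show ?thesis using True a by (auto simp: dashv_le_def card_sat_Int)
qed (simp add: dashv_le_def)

text \<open>If \<open>p'\<close> is finer, then \<open>sat p' \<inter> sat p = sat p\<close>, and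
  comparing exponents of 2 leaves the defining equation of \<open>sqsup_le\<close>.\<close>

lemma sqsup_le_iff: "sqsup_le p' p \<longleftrightarrow> geod_le p' p \<and> coarser p p'"
proof (cases "coarser p p'")
  case True
  then have a: "arity p' = arity p" and sub: "sat p' \<inter> sat p = sat p" by (auto simp: coarser_iff)
  let ?i = "id_part (arity p)"
  have "geod_le p' p \<longleftrightarrow> (2::nat) ^ (nc (blocks p') + nc_join p ?i) = 2 ^ (nc_join p' ?i + nc (blocks p))"
    using a by (simp add: geod_le_iff sub card_sat_Int card_sat power_add)
  also have "\<dots> \<longleftrightarrow> nc (blocks p') + nc_join p ?i = nc_join p' ?i + nc (blocks p)" by simp
  finally show ?thesis using True a by (auto simp: sqsup_le_def)
qed (simp add: sqsup_le_def)

section \<open>Tensor products\<close>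

abbreviation shift :: "nat \<Rightarrow> nat + nat \<Rightarrow> nat + nat" where
  "shift k \<equiv> map_sum ((+) k) ((+) k)"

text \<open>The effect of \<open>tensor\<close> on label sets; it turns pairs of unions of blocks
  into unions of blocks of the tensor product, see \<open>sat_tensor\<close>.\<close>

definition glue :: "nat \<Rightarrow> (nat + nat) set \<times> (nat + nat) set \<Rightarrow> (nat + nat) set" where
  "glue k = (\<lambda>(U, V). U \<union> shift k ` V)"

lemma inj_shift: "inj (shift k)"
  by (simp add: sum.inj_map)

lemma labels_add: "labels (k + l) = labels k \<union> shift k ` labels l"
proof -
  have "(+) k ` {1..l} = {k+1..k+l}" by (simp add: add.commute)
  then have s_labels: "shift k ` labels l = {k+1..k+l} <+> {k+1..k+l}"
    by (simp only: labels_def map_sum_Plus)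
  show ?thesis
    unfolding s_labels
  proof (rule set_eqI)
    fix x show "x \<in> labels (k + l) \<longleftrightarrow> x \<in> labels k \<union> ({k+1..k+l} <+> {k+1..k+l})"
      by (cases x) (auto simp: labels_def)
  qed
qed

lemma labels_disjoint: "labels k \<inter> shift k ` labels l = {}"
  by (auto simp: labels_def)

lemma arity_tensor [simp]: "arity (tensor p q) = arity p + arity q"
  by transfer auto

lemma blocks_tensor: "blocks (tensor p q) = blocks p \<union> (`) (shift (arity p)) ` blocks q"
  by transfer auto

lemma sat_tensor: "sat (tensor p q) = glue (arity p) ` (sat p \<times> sat q)"
proof -
  have "sat p \<times> (`) (shift (arity p)) ` sat q = apsnd ((`) (shift (arity p))) ` (sat p \<times> sat q)"
    by force
  then show ?thesis
    by (simp add: blocks_tensor saturated_Un saturated_image image_image glue_def case_prod_beta)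
qed

text \<open>The two components are recovered by intersecting with \<open>labels k\<close> and by
  removing \<open>labels k\<close>.\<close>

lemma inj_on_glue: "inj_on (glue k) (Pow (labels k) \<times> Pow (labels l))"
proof (rule inj_onI, clarify)
  fix U V U' V'
  assume s: "U \<subseteq> labels k" "V \<subseteq> labels l" "U' \<subseteq> labels k" "V' \<subseteq> labels l"
    and "glue k (U, V) = glue k (U', V')"
  then have eq: "U \<union> shift k ` V = U' \<union> shift k ` V'" by (simp add: glue_def)
  have d: "labels k \<inter> shift k ` V = {}" "labels k \<inter> shift k ` V' = {}"
    using labels_disjoint[of k l] s by blast+
  have "U = (U \<union> shift k ` V) \<inter> labels k" "U' = (U' \<union> shift k ` V') \<inter> labels k"
    using d s by blast+
  then have "U = U'" unfolding eq by simp
  moreover have "shift k ` V = (U \<union> shift k ` V) - labels k" "shift k ` V' = (U' \<union> shift k ` V') - labels k"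
    using d s by blast+
  then have "shift k ` V = shift k ` V'" unfolding eq by simp
  ultimately show "U = U' \<and> V = V'" using inj_image_eq_iff[OF inj_shift] by blast
qed

lemma sat_times_subset: "sat p \<times> sat q \<subseteq> Pow (labels (arity p)) \<times> Pow (labels (arity q))"
  using sat_subset by blast

lemma sat_tensor_Int:
  assumes "arity p' = arity p" "arity q' = arity q"
  shows "sat (tensor p q) \<inter> sat (tensor p' q') = glue (arity p) ` ((sat p \<inter> sat p') \<times> (sat q \<inter> sat q'))"
  unfolding sat_tensor assms
  using inj_on_image_Int[OF inj_on_glue sat_times_subset sat_times_subset[of p' q', unfolded assms]]
  by (simp add: Times_Int_Times)

lemma card_sat_tensor: "card (sat (tensor p q)) = card (sat p) * card (sat q)"
  unfolding sat_tensor
  by (simp add: card_image[OF inj_on_subset[OF inj_on_glue sat_times_subset]] card_cartesian_product)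

lemma card_sat_tensor_Int:
  assumes "arity p' = arity p" "arity q' = arity q"
  shows "card (sat (tensor p q) \<inter> sat (tensor p' q')) = card (sat p \<inter> sat p') * card (sat q \<inter> sat q')"
proof -
  have "inj_on (glue (arity p)) ((sat p \<inter> sat p') \<times> (sat q \<inter> sat q'))"
    by (rule inj_on_subset[OF inj_on_glue[of _ "arity q"]]) (use sat_subset in blast)
  then show ?thesis
    by (simp add: sat_tensor_Int[OF assms] card_image card_cartesian_product)
qed

section \<open>Orders on tensor products\<close>

lemma sat_inject:
  assumes "arity p = arity q" "sat p = sat q"
  shows "p = q"
proof -
  have "coarser p q" "coarser q p" using assms by (auto simp: coarser_iff)
  then have "blocks p = blocks q" using assms(1) by (intro refines_asym[of "labels (arity p)"]) (simp_all add: coarser_def)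
  then show ?thesis using assms(1) by (intro part_eqI)
qed

text \<open>Injectivity of \<open>glue\<close> reduces the claim to an inclusion of products. Their
  factors contain \<open>{}\<close>, so it splits into inclusions of the factors.\<close>

lemma coarser_tensor:
  assumes "arity p' = arity p" "arity q' = arity q"
  shows "coarser (tensor p' q') (tensor p q) \<longleftrightarrow> coarser p' p \<and> coarser q' q"
proof -
  have ne: "sat p' \<noteq> {}" "sat q' \<noteq> {}" using empty_in_saturated by blast+
  have "sat (tensor p' q') \<subseteq> sat (tensor p q) \<longleftrightarrow> sat p' \<times> sat q' \<subseteq> sat p \<times> sat q"
    unfolding sat_tensor assms
    using inj_on_image_Int[OF inj_on_glue sat_times_subset[of p' q', unfolded assms] sat_times_subset[of p q]]
      inj_on_image_eq_iff[OF inj_on_glue _ sat_times_subset[of p' q', unfolded assms],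
        of "sat p' \<times> sat q' \<inter> sat p \<times> sat q"] sat_times_subset[of p' q', unfolded assms]
    by (metis inf.absorb_iff1 le_infI1)
  also have "\<dots> \<longleftrightarrow> sat p' \<subseteq> sat p \<and> sat q' \<subseteq> sat q" using ne by (auto simp: Times_subset_cancel2)
  finally show ?thesis using assms by (simp add: coarser_iff)
qed

text \<open>Equal tensor products are coarser than each other, and by \<open>coarser_tensor\<close>
  so are their factors.\<close>

lemma tensor_inject:
  assumes "arity p' = arity p" "arity q' = arity q" "tensor p' q' = tensor p q"
  shows "p' = p \<and> q' = q"
proof -
  have "coarser x x" for x by (simp add: coarser_iff)
  then have "coarser p' p \<and> coarser q' q" "coarser p p' \<and> coarser q q'"
    using coarser_tensor[of p' p q' q] coarser_tensor[of p p' q q'] assms by metis+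
  then show ?thesis using assms by (auto simp: coarser_iff intro: sat_inject)
qed

lemma blocks_id_part: "blocks (id_part k) = id_blocks k"
  by transfer simp

lemma id_part_add: "id_part (k + l) = tensor (id_part k) (id_part l)"
proof (rule part_eqI)
  have "{1..k + l} = {1..k} \<union> (+) k ` {1..l}"
  proof -
    have "(+) k ` {1..l} = {k+1..k+l}" by (simp add: add.commute)
    then show ?thesis by auto
  qed
  then show "blocks (id_part (k + l)) = blocks (tensor (id_part k) (id_part l))"
    by (simp only: blocks_tensor blocks_id_part id_blocks_def arity_id_part image_Un image_image)
       (simp add: image_image)
qed simp

text \<open>A strict inequality in one factor would be strict in the product, by positivity.\<close>

lemma mult_eq_mult_le_iff:
  fixes a b c d :: nat
  assumes "a \<le> c" "b \<le> d" "0 < a" "0 < b"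
  shows "c * d = a * b \<longleftrightarrow> c = a \<and> d = b"
  using assms by (metis le_neq_implies_less mult_less_le_imp_less mult_le_less_imp_less nat_less_le zero_le)

text \<open>All cardinalities in \<open>geod_le_iff\<close> are multiplicative. The triangle
  inequality holds for each factor, so equality for the product forces equality for both.\<close>

lemma geod_le_tensor:
  assumes "arity p' = arity p" "arity q' = arity q"
  shows "geod_le (tensor p' q') (tensor p q) \<longleftrightarrow> geod_le p' p \<and> geod_le q' q"
proof -
  have pos: "0 < card (sat x \<inter> sat y)" for x y
  proof -
    have "{} \<in> sat x \<inter> sat y" by simp
    then show ?thesis by (metis card_gt_0_iff empty_iff finite_Int finite_sat)
  qed
  let ?c = "\<lambda>p p'. card (sat p') * card (sat p \<inter> sat (id_part (arity p)))"
  let ?a = "\<lambda>p p'. card (sat p' \<inter> sat (id_part (arity p))) * card (sat p' \<inter> sat p)"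
  have "geod_le (tensor p' q') (tensor p q) \<longleftrightarrow> ?c p p' * ?c q q' = ?a p p' * ?a q q'"
    using assms by (simp add: geod_le_iff id_part_add card_sat_tensor card_sat_tensor_Int mult.assoc mult.left_commute mult.commute)
  also have "\<dots> \<longleftrightarrow> ?c p p' = ?a p p' \<and> ?c q q' = ?a q q'"
    by (rule mult_eq_mult_le_iff) (auto simp: card_sat_Int_mult_le pos)
  finally show ?thesis using assms by (simp add: geod_le_iff)
qed

lemma part_exists:
  assumes "partition_on (labels k) P"
  shows "\<exists>p. arity p = k \<and> blocks p = P"
  using assms by transfer auto

text \<open>Since \<open>labels k\<close> is a union of blocks, no block crosses between the two
  groups of labels.\<close>

lemma tensor_split:
  assumes ar: "arity r = k + l" and L: "labels k \<in> sat r"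
  shows "\<exists>p q. arity p = k \<and> arity q = l \<and> r = tensor p q"
proof -
  define P Q where "P = {B \<in> blocks r. B \<subseteq> labels k}" and "Q = {B \<in> blocks r. \<not> B \<subseteq> labels k}"
  \<comment> \<open>A left inverse of \<open>shift k\<close>. It is applied only to shifted labels,
    where the truncated subtraction is exact.\<close>
  define u where "u = (map_sum (\<lambda>x. x - k) (\<lambda>x. x - k) :: nat + nat \<Rightarrow> nat + nat)"
  note r = partition_on_blocks[of r, unfolded ar]
  have ur: "\<Union>(blocks r) = labels k \<union> shift k ` labels l"
    using partition_onD1[OF r] labels_add by metis
  have Qd: "B \<inter> labels k = {}" if "B \<in> Q" for B
    using L that in_saturated_iff[OF r] by (auto simp: Q_def)
  have PQ: "blocks r = P \<union> Q" by (auto simp: P_def Q_def)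
  have Pu: "\<Union>P = labels k"
  proof
    show "labels k \<subseteq> \<Union>P"
    proof
      fix x assume x: "x \<in> labels k"
      then obtain B where "B \<in> blocks r" "x \<in> B" using ur by blast
      then show "x \<in> \<Union>P" using Qd x PQ by blast
    qed
  qed (auto simp: P_def)
  have Qu: "\<Union>Q = shift k ` labels l"
  proof
    show "\<Union>Q \<subseteq> shift k ` labels l" using Qd ur PQ by blast
    show "shift k ` labels l \<subseteq> \<Union>Q"
      using ur PQ Pu labels_disjoint[of k l] by blast
  qed
  have "partition_on (labels k) P"
    using r Pu by (auto simp: P_def partition_on_def disjoint_def)
  then obtain p where p: "arity p = k" "blocks p = P" using part_exists by blast
  have "partition_on (shift k ` labels l) Q"
    using r Qu by (auto simp: Q_def partition_on_def disjoint_def)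
  moreover have us: "u (shift k x) = x" for x by (cases x) (auto simp: u_def)
  then have "inj_on u (shift k ` labels l)" by (intro inj_onI) auto
  ultimately have "partition_on (u ` shift k ` labels l) ((`) u ` Q)"
    unfolding u_def by (rule image_map_sum_labels)
  moreover have "u ` shift k ` labels l = labels l" by (simp add: image_image us)
  ultimately obtain q where q: "arity q = l" "blocks q = (`) u ` Q"
    using part_exists[of l "(`) u ` Q"] by auto
  have "shift k ` u ` B = B" if "B \<in> Q" for B
  proof -
    have "shift k (u x) = x" if "x \<in> B" for x
    proof -
      have "x \<in> shift k ` labels l" unfolding Qu[symmetric] using that \<open>B \<in> Q\<close> by (rule UnionI[rotated])
      then show ?thesis by (auto simp: us)
    qed
    then show ?thesis by (force simp: image_image)
  qed
  then have "(`) (shift k) ` blocks q = Q" by (simp add: q image_image)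
  then have "r = tensor p q" using ar p q PQ by (intro part_eqI) (simp_all add: blocks_tensor)
  then show ?thesis using p q by blast
qed

text \<open>The labels of \<open>p\<close> form a union of blocks both of the tensor product and of
  the identity, and equality in the triangle inequality passes this on to \<open>r\<close>.\<close>

lemma geod_le_tensor_split:
  assumes "geod_le r (tensor p q)"
  shows "\<exists>p' q'. arity p' = arity p \<and> arity q' = arity q \<and> r = tensor p' q'"
proof (rule tensor_split)
  let ?t = "tensor p q" and ?i = "id_part (arity p + arity q)"
  show ar: "arity r = arity p + arity q" using assms by (simp add: geod_le_iff)
  \<comment> \<open>The product formula bounds the right-hand side of \<open>geod_le_iff\<close>;
    cancelling \<open>card (sat r)\<close> leaves a bound that forces equality of the two
    intersections.\<close>
  have "card (sat r) * card (sat ?t \<inter> sat ?i) \<le> card (sat r) * card (sat r \<inter> sat ?i \<inter> sat ?t)"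
    using assms card_sat_Int_mult_le_Int[of r ?i ?t] by (simp add: geod_le_iff)
  then have "card (sat ?t \<inter> sat ?i) \<le> card (sat r \<inter> sat ?i \<inter> sat ?t)"
    by (simp add: card_sat)
  then have "sat r \<inter> sat ?i \<inter> sat ?t = sat ?t \<inter> sat ?i"
    by (intro card_seteq) auto
  moreover have "labels (arity p) \<in> sat (tensor p q')" for q'
  proof -
    have "labels (arity p) \<in> sat p"
      using partition_onD1[OF partition_on_blocks[of p]] by (auto simp: saturated_def)
    then show ?thesis
      unfolding sat_tensor by (intro image_eqI[where x = "(labels (arity p), {})"]) (auto simp: glue_def)
  qed
  moreover have "labels (arity p) \<in> sat ?i"
  proof -
    have "labels (arity p) \<in> sat (id_part (arity p))"
      using partition_onD1[OF partition_on_blocks[of "id_part (arity p)"]] by (auto simp: saturated_def)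
    then show ?thesis
      unfolding id_part_add sat_tensor
      by (intro image_eqI[where x = "(labels (arity p), {})"]) (auto simp: glue_def)
  qed
  ultimately show "labels (arity p) \<in> sat r" by blast
qed

section \<open>Permutations\<close>

lemma arity_permute [simp]: "arity (permute \<sigma> p) = arity p"
  by transfer auto

lemma blocks_permute:
  "\<sigma> permutes {1..arity p} \<Longrightarrow> blocks (permute \<sigma> p) = (`) (map_sum \<sigma> \<sigma>) ` blocks p"
  by transfer auto

lemma sat_permute:
  "\<sigma> permutes {1..arity p} \<Longrightarrow> sat (permute \<sigma> p) = (`) (map_sum \<sigma> \<sigma>) ` sat p"
  by (simp only: blocks_permute saturated_image)

lemma permute_id_part: "\<sigma> permutes {1..k} \<Longrightarrow> permute \<sigma> (id_part k) = id_part k"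
proof (rule part_eqI)
  assume s: "\<sigma> permutes {1..k}"
  have "blocks (permute \<sigma> (id_part k)) = (\<lambda>i. {Inl i, Inr i}) ` (\<sigma> ` {1..k})"
    using s by (subst blocks_permute) (simp_all add: blocks_id_part id_blocks_def image_image)
  then show "blocks (permute \<sigma> (id_part k)) = blocks (id_part k)"
    by (simp only: permutes_image[OF s] blocks_id_part id_blocks_def)
qed simp

lemma inj_image_permutes: "\<sigma> permutes S \<Longrightarrow> inj ((`) (map_sum \<sigma> \<sigma>))"
  by (intro inj_onI) (simp add: inj_image_eq_iff sum.inj_map permutes_inj)

lemma coarser_permute:
  assumes "\<sigma> permutes {1..arity p}" "arity p' = arity p"
  shows "coarser (permute \<sigma> p') (permute \<sigma> p) \<longleftrightarrow> coarser p' p"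
  using assms by (simp add: coarser_iff sat_permute inj_image_subset_iff[OF inj_image_permutes] del: One_nat_def)

text \<open>A permutation of labels acts injectively on label sets, so it preserves the
  cardinalities in \<open>geod_le_iff\<close>, and it fixes the identity partition.\<close>

lemma geod_le_permute:
  assumes s: "\<sigma> permutes {1..arity p}" and a: "arity p' = arity p"
  shows "geod_le (permute \<sigma> p') (permute \<sigma> p) \<longleftrightarrow> geod_le p' p"
proof -
  note inj = inj_image_permutes[OF s]
  have card1: "card (sat (permute \<sigma> q)) = card (sat q)" if "arity q = arity p" for q
    using s that card_image[OF inj_on_subset[OF inj subset_UNIV]] by (simp add: sat_permute)
  have card2: "card (sat (permute \<sigma> q) \<inter> sat (permute \<sigma> r)) = card (sat q \<inter> sat r)"
    if "arity q = arity p" "arity r = arity p" for q r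
    using s that card_image[OF inj_on_subset[OF inj subset_UNIV]]
    by (simp add: sat_permute image_Int[OF inj, symmetric])
  show ?thesis
    using card1[OF a] card2[OF a refl] card2[of p "id_part (arity p)"] card2[of p' "id_part (arity p)"] a s
    by (simp add: geod_le_iff permute_id_part del: One_nat_def)
qed

lemma permute_inject:
  assumes s: "\<sigma> permutes {1..arity p}" and a: "arity p' = arity p"
    and e: "permute \<sigma> p' = permute \<sigma> p"
  shows "p' = p"
  using assms inj_image_eq_iff[OF inj_image_permutes[OF s]]
  by (intro sat_inject) (metis sat_permute)+

lemma permute_surj:
  assumes s: "\<sigma> permutes {1..arity r}"
  shows "\<exists>p. arity p = arity r \<and> r = permute \<sigma> p"
proof (intro exI conjI)
  let ?p = "permute (inv \<sigma>) r"
  note i = permutes_inv[OF s]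
  show "arity ?p = arity r" by simp
  have "map_sum \<sigma> \<sigma> ` map_sum (inv \<sigma>) (inv \<sigma>) ` B = B" for B
    using permutes_inverses(1)[OF s] by (simp add: image_image sum.map_comp o_def sum.map_id0 flip: id_def)
  then have "blocks (permute \<sigma> ?p) = blocks r"
    using s i by (simp add: blocks_permute image_image del: One_nat_def)
  then show "r = permute \<sigma> ?p" by (intro part_eqI) simp_all
qed

section \<open>Transforms of characters\<close>

lemma geod_le_refl: "geod_le p p"
  by (simp add: geod_le_iff Int_commute mult.commute)

text \<open>A strict step down shortens the distance to the identity by
  \<open>pdist p' p > 0\<close>. Twice a distance is an integer, so the floor loses nothing.\<close>

lemma wf_geod_le: "wf {(p', p). geod_le p' p \<and> p' \<noteq> p}"
proof (rule wf_subset)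
  let ?h = "\<lambda>p. nat \<lfloor>2 * pdist (id_part (arity p)) p\<rfloor>"
  show "wf (measure ?h)" by simp
  have "?h p' < ?h p" if le: "geod_le p' p" and ne: "p' \<noteq> p" for p p'
  proof -
    have a: "arity p' = arity p" using le by (simp add: geod_le_def)
    have int: "\<exists>z. 2 * pdist x y = real_of_int z" for x y
      by (rule exI[of _ "int (nc (blocks x)) + int (nc (blocks y)) - 2 * int (nc_join x y)"])
         (simp add: pdist_def)
    have "pdist (id_part (arity p')) p' < pdist (id_part (arity p)) p"
      using le pdist_pos[OF a ne] a by (simp add: geod_le_def)
    moreover have "0 \<le> pdist (id_part (arity p')) p'" by (rule pdist_nonneg) simp
    moreover obtain z z' where "2 * pdist (id_part (arity p)) p = real_of_int z"
      "2 * pdist (id_part (arity p')) p' = real_of_int z'" using int by metis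
    ultimately show ?thesis by simp
  qed
  then show "{(p', p). geod_le p' p \<and> p' \<noteq> p} \<subseteq> measure ?h" by auto
qed

text \<open>These properties are common to the three orders, so one argument serves all transforms.
  \<open>le_geod\<close> brings in well-foundedness, finiteness of down-sets and the splitting of
  elements below a tensor product.\<close>

locale multiplicative_order =
  fixes le :: "part \<Rightarrow> part \<Rightarrow> bool"
  assumes le_geod: "le p' p \<Longrightarrow> geod_le p' p"
    and le_refl: "le p p"
    and le_permute: "\<sigma> permutes {1..arity p} \<Longrightarrow> arity p' = arity p \<Longrightarrow>
      le (permute \<sigma> p') (permute \<sigma> p) \<longleftrightarrow> le p' p"
    and le_tensor: "arity p' = arity p \<Longrightarrow> arity q' = arity q \<Longrightarrow>
      le (tensor p' q') (tensor p q) \<longleftrightarrow> le p' p \<and> le q' q"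
begin

definition transform :: "((part \<Rightarrow>\<^sub>0 complex) \<Rightarrow> complex) \<Rightarrow> (part \<Rightarrow>\<^sub>0 complex) \<Rightarrow> complex" where
  "transform \<phi> = extend (\<lambda>p. \<Sum>p' | le p' p. \<phi> (basis p'))"

lemma transform_basis: "transform \<phi> (basis p) = (\<Sum>p' | le p' p. \<phi> (basis p'))"
  by (simp add: transform_def)

lemma le_arity: "le p' p \<Longrightarrow> arity p' = arity p"
  using le_geod geod_le_iff by blast

lemma finite_le: "finite {p'. le p' p}"
  by (rule finite_subset[OF _ finite_arity[of "arity p"]]) (auto simp: le_arity)

lemma bij_betw_transform_linear: "bij_betw transform linear_forms linear_forms"
proof -
  have "bij_betw (\<lambda>\<phi>. extend (\<lambda>p. \<Sum>p' | le p' p. \<phi> (basis p'))) linear_forms linear_forms"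
    by (rule bij_betw_extend_sum[OF wf_geod_le finite_le le_refl]) (simp add: le_geod)
  then show ?thesis by (simp add: transform_def[abs_def])
qed

lemma le_permute_eq:
  assumes s: "\<sigma> permutes {1..arity p}"
  shows "{p'. le p' (permute \<sigma> p)} = permute \<sigma> ` {p'. le p' p}"
proof (intro equalityI subsetI)
  fix r assume "r \<in> {p'. le p' (permute \<sigma> p)}"
  then have r: "le r (permute \<sigma> p)" by simp
  then have a: "arity r = arity p" using le_arity by fastforce
  then obtain p' where p': "arity p' = arity r" "r = permute \<sigma> p'" using permute_surj s by metis
  then have "le p' p" using r s a by (simp add: le_permute)
  then show "r \<in> permute \<sigma> ` {p'. le p' p}" using p'(2) by blast
next
  fix r assume "r \<in> permute \<sigma> ` {p'. le p' p}"
  then obtain p' where "le p' p" "r = permute \<sigma> p'" by blast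
  then show "r \<in> {p'. le p' (permute \<sigma> p)}" using s by (simp add: le_permute le_arity)
qed

lemma sum_permute:
  fixes f :: "part \<Rightarrow> complex"
  assumes s: "\<sigma> permutes {1..arity p}"
  shows "(\<Sum>p' | le p' (permute \<sigma> p). f p') = (\<Sum>p' | le p' p. f (permute \<sigma> p'))"
proof -
  have "inj_on (permute \<sigma>) {p'. le p' p}"
  proof (rule inj_onI)
    fix x y assume "x \<in> {p'. le p' p}" "y \<in> {p'. le p' p}" "permute \<sigma> x = permute \<sigma> y"
    then show "x = y" using permute_inject[of \<sigma> y x] s by (simp add: le_arity)
  qed
  then show ?thesis by (simp only: le_permute_eq[OF s] sum.reindex o_def)
qed

text \<open>An element below \<open>tensor p q\<close> splits by
  \<open>geod_le_tensor_split\<close>, and \<open>le_tensor\<close> then compares the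
  factors.\<close>

lemma le_tensor_eq:
  "{r. le r (tensor p q)} = (\<lambda>(p', q'). tensor p' q') ` ({p'. le p' p} \<times> {q'. le q' q})"
proof (intro equalityI subsetI)
  fix r assume "r \<in> {r. le r (tensor p q)}"
  then have r: "le r (tensor p q)" by simp
  then obtain p' q' where "arity p' = arity p" "arity q' = arity q" "r = tensor p' q'"
    using geod_le_tensor_split[OF le_geod] by blast
  then show "r \<in> (\<lambda>(p', q'). tensor p' q') ` ({p'. le p' p} \<times> {q'. le q' q})"
    using r by (auto simp: le_tensor)
next
  fix r assume "r \<in> (\<lambda>(p', q'). tensor p' q') ` ({p'. le p' p} \<times> {q'. le q' q})"
  then show "r \<in> {r. le r (tensor p q)}" by (auto simp: le_tensor le_arity)
qed

lemma sum_tensor: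
  fixes f :: "part \<Rightarrow> complex"
  shows "(\<Sum>r | le r (tensor p q). f r) = (\<Sum>(p', q')\<in>{p'. le p' p} \<times> {q'. le q' q}. f (tensor p' q'))"
proof -
  have "inj_on (\<lambda>(p', q'). tensor p' q') ({p'. le p' p} \<times> {q'. le q' q})"
  proof (rule inj_onI, clarify)
    fix x y x' y' assume "le x p" "le x' p" "le y q" "le y' q" "tensor x y = tensor x' y'"
    then show "x = x' \<and> y = y'" using tensor_inject[of x x' y y'] by (simp add: le_arity)
  qed
  then show ?thesis by (simp add: le_tensor_eq sum.reindex o_def case_prod_unfold)
qed

lemma transform_tensor_basis:
  "transform \<phi> (basis p) * transform \<phi> (basis q) =
    (\<Sum>(p', q')\<in>{p'. le p' p} \<times> {q'. le q' q}. \<phi> (basis p') * \<phi> (basis q'))"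
  by (simp add: transform_basis sum_product sum.cartesian_product)

text \<open>The empty partition is the only one of arity 0, so its down-set is a singleton.\<close>

lemma transform_empty: "transform \<phi> (basis empty_part) = \<phi> (basis empty_part)"
proof -
  have ae: "arity empty_part = 0" by transfer simp
  have "p = empty_part" if "arity p = 0" for p
  proof -
    have "blocks x = {}" if "arity x = 0" for x
      using partition_on_blocks[of x] that by (simp add: labels_def Plus_def partition_on_empty)
    then show ?thesis using that ae by (intro part_eqI) simp_all
  qed
  then have "{p'. le p' empty_part} = {empty_part}" using le_arity ae le_refl by fastforce
  then show ?thesis by (simp add: transform_basis)
qed

text \<open>Permuting the labels reindexes the down-set, and the down-set of a tensor product is a
  product, so the sum over it factors.\<close>

lemma transform_in_characters:
  assumes "\<phi> \<in> characters"
  shows "transform \<phi> \<in> characters"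
proof -
  have inv: "\<phi> (basis (permute \<sigma> p)) = \<phi> (basis p)" if "\<sigma> permutes {1..arity p}" for \<sigma> p
    using assms that unfolding characters_def invariant_forms_def by blast
  have mult: "\<phi> (basis (tensor p q)) = \<phi> (basis p) * \<phi> (basis q)" for p q
    using assms unfolding characters_def by blast
  have "transform \<phi> \<in> linear_forms" by (simp only: transform_def extend_linear)
  moreover have "transform \<phi> (basis (permute \<sigma> p)) = transform \<phi> (basis p)"
    if s: "\<sigma> permutes {1..arity p}" for \<sigma> p
    unfolding transform_basis sum_permute[OF s]
    by (rule sum.cong) (use s in \<open>simp_all add: inv le_arity\<close>)
  moreover have "transform \<phi> (basis (tensor p q)) = transform \<phi> (basis p) * transform \<phi> (basis q)" for p q
    unfolding transform_tensor_basis by (simp add: transform_basis sum_tensor mult)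
  moreover have "transform \<phi> (basis empty_part) = 1"
    using assms by (simp add: transform_empty characters_def)
  ultimately show ?thesis by (simp add: characters_def invariant_forms_def)
qed

text \<open>Each instance of invariance or multiplicativity of \<open>transform \<phi>\<close> is an equality of sums over
  a down-set; by induction all terms but the top one agree, hence so do the top ones.\<close>

lemma characters_of_transform:
  assumes lin: "\<phi> \<in> linear_forms" and ch: "transform \<phi> \<in> characters"
  shows "\<phi> \<in> characters"
proof -
  have "\<phi> (basis (permute \<sigma> p)) = \<phi> (basis p)" if "\<sigma> permutes {1..arity p}" for \<sigma> p
    using that
  proof (induction p rule: wf_induct_rule[OF wf_geod_le])
    case (1 p)
    let ?D = "{p'. le p' p}"
    have IH: "\<phi> (basis (permute \<sigma> p')) = \<phi> (basis p')" if "p' \<in> ?D - {p}" for p'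
    proof -
      have p': "le p' p" "p' \<noteq> p" using that by auto
      then show ?thesis using 1(1)[of p'] 1(2) by (simp add: le_geod le_arity del: One_nat_def)
    qed
    have "transform \<phi> (basis (permute \<sigma> p)) = transform \<phi> (basis p)"
      using ch 1(2) unfolding characters_def invariant_forms_def by blast
    then have "(\<Sum>p'\<in>?D. \<phi> (basis (permute \<sigma> p'))) = (\<Sum>p'\<in>?D. \<phi> (basis p'))"
      by (simp only: transform_basis sum_permute[OF 1(2)])
    moreover have "(\<Sum>p'\<in>?D - {p}. \<phi> (basis (permute \<sigma> p'))) = (\<Sum>p'\<in>?D - {p}. \<phi> (basis p'))"
      by (rule sum.cong[OF refl IH])
    ultimately show ?case
      using sum.remove[OF finite_le, of p p "\<lambda>p'. \<phi> (basis (permute \<sigma> p'))"]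
        sum.remove[OF finite_le, of p p "\<lambda>p'. \<phi> (basis p')"] le_refl by simp
  qed
  moreover have "\<phi> (basis (tensor p q)) = \<phi> (basis p) * \<phi> (basis q)" for p q
  \<comment> \<open>The induction runs over the tensor product itself, so that its hypothesis covers
    every pair of factors below, including those where only one factor changes.\<close>
  proof (induction "tensor p q" arbitrary: p q rule: wf_induct_rule[OF wf_geod_le])
    case (1 p q)
    let ?D = "{p'. le p' p} \<times> {q'. le q' q}"
    let ?f = "\<lambda>(p', q'). \<phi> (basis (tensor p' q'))" and ?g = "\<lambda>(p', q'). \<phi> (basis p') * \<phi> (basis q')"
    have IH: "?f z = ?g z" if "z \<in> ?D - {(p, q)}" for z
    proof -
      obtain p' q' where z: "z = (p', q')" by (cases z)
      have le: "le p' p" "le q' q" "(p', q') \<noteq> (p, q)" using that z by auto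
      have "le (tensor p' q') (tensor p q)" using le by (simp add: le_tensor le_arity)
      moreover have "tensor p' q' \<noteq> tensor p q"
        using tensor_inject[of p' p q' q] le le_arity by blast
      ultimately show ?thesis using 1[of p' q'] le_geod z by simp
    qed
    have "transform \<phi> (basis (tensor p q)) = transform \<phi> (basis p) * transform \<phi> (basis q)"
      using ch unfolding characters_def by blast
    then have "sum ?f ?D = sum ?g ?D"
      unfolding transform_tensor_basis by (simp only: transform_basis sum_tensor)
    moreover have "sum ?f (?D - {(p, q)}) = sum ?g (?D - {(p, q)})"
      by (rule sum.cong[OF refl IH])
    moreover have "finite ?D" "(p, q) \<in> ?D" using finite_le le_refl by simp_all
    ultimately show ?case
      using sum.remove[of ?D "(p, q)" ?f] sum.remove[of ?D "(p, q)" ?g] by simp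
  qed
  moreover have "\<phi> (basis empty_part) = 1"
    using ch by (simp add: transform_empty characters_def)
  ultimately show ?thesis using lin by (simp add: characters_def invariant_forms_def)
qed

text \<open>A preimage exists among the linear forms, and \<open>characters_of_transform\<close>
  shows that it is a character.\<close>

lemma transform_image_characters: "transform ` characters = characters"
proof
  show "transform ` characters \<subseteq> characters" using transform_in_characters by blast
  show "characters \<subseteq> transform ` characters"
  proof
    fix \<psi> assume \<psi>: "\<psi> \<in> characters"
    then have "\<psi> \<in> linear_forms" by (simp add: characters_def invariant_forms_def)
    then obtain \<phi> where "\<phi> \<in> linear_forms" "\<psi> = transform \<phi>"
      using bij_betw_imp_surj_on[OF bij_betw_transform_linear] by blast
    then show "\<psi> \<in> transform ` characters" using characters_of_transform \<psi> by blast
  qed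
qed

lemma bij_betw_transform: "bij_betw transform characters characters"
  by (rule bij_betw_subset[OF bij_betw_transform_linear _ transform_image_characters])
     (auto simp: characters_def invariant_forms_def)

end

interpretation geod: multiplicative_order geod_le
  by unfold_locales (simp_all add: geod_le_refl geod_le_permute geod_le_tensor del: One_nat_def)

text \<open>The order is the intersection of \<open>geod_le\<close> with \<open>coarser\<close>, and
  both respect permutations and tensor products.\<close>

interpretation dashv: multiplicative_order dashv_le
  by unfold_locales
     (auto simp: dashv_le_iff geod_le_refl geod_le_permute geod_le_tensor
        coarser_permute coarser_tensor coarser_iff[of p p for p] simp del: One_nat_def)

interpretation sqsup: multiplicative_order sqsup_le
  by unfold_locales
     (auto simp: sqsup_le_iff geod_le_refl geod_le_permute geod_le_tensor
        coarser_permute coarser_tensor coarser_iff[of p p for p] simp del: One_nat_def)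

theorem proposition4p5:
  "bij_betw M_transform characters characters \<and>
   bij_betw R_transform characters characters \<and>
   bij_betw Mtoc_transform characters characters \<and>
   bij_betw Mcto_transform characters characters"
proof -
  have M: "M_transform = geod.transform"
    by (simp add: fun_eq_iff M_transform_def geod.transform_def)
  have "Mtoc_transform = sqsup.transform" "Mcto_transform = dashv.transform"
    by (simp_all add: fun_eq_iff Mtoc_transform_def sqsup.transform_def
        Mcto_transform_def dashv.transform_def)
  \<comment> \<open>\<open>R_transform\<close> inverts \<open>M_transform\<close> on all linear
    forms; it restricts to characters because \<open>M_transform\<close> maps them onto
    themselves.\<close>
  moreover have "bij_betw R_transform characters characters"
    unfolding R_transform_def
  proof (rule bij_betw_inv_into_subset[OF bij_betw_M_transform])
    show "characters \<subseteq> linear_forms" by (auto simp: characters_def invariant_forms_def)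
    show "M_transform ` characters = characters" by (simp add: M geod.transform_image_characters)
  qed
  ultimately show ?thesis
    using geod.bij_betw_transform sqsup.bij_betw_transform dashv.bij_betw_transform M by simp
qed

end
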